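(* Let $(M,w)$ and $(M',w')$ be pointed models such that $(M,w)$ and $(M',w')$ are collectively $\mathtt{P}$-bisimilar. Then for every formula $\psi$ of the language $\mathcal{L}_{[S,\chi]}$ of partial communication, $(M,w)\Vdash\psi$ if and only if $(M',w')\Vdash\psi$.
   Context: Fix a finite non-empty set of agents $A$ and a non-empty countable set of atoms $\mathtt{P}$. A model is $M=\langle W,R,V\rangle$ with $W$ a non-empty set of worlds, $R=\{R_i\subseteq W\times W\mid i\in A\}$ arbitrary binary relations, and $V:\mathtt{P}\to\mathcal{P}(W)$. For $G\subseteq A$ put $R_G:=\bigcap_{k\in G}R_k$ (with $R_\emptyset:=W\times W$). A pointed model is $(M,w)$ with $w\in W$. The language $\mathcal{L}_D$ is given by $\varphi::=p\mid\lnot\varphi\mid\varphi\land\varphi\mid D_G\varphi$ for $p\in\mathtt{P}$ and $\emptyset\neq G\subseteq A$, with $(M,w)\Vdash p$ iff $w\in V(p)$, Boolean clauses as usual, and $(M,w)\Vdash D_G\varphi$ iff $(M,u)\Vdash\varphi$ for all $u$ with $(w,u)\in R_G$. For a formula $\chi$ and model $M$, $\|\chi\|^M$ is the set of worlds of $M$ where $\chi$ holds, and $\sim^M_\chi:=(\|\chi\|^M\times\|\chi\|^M)\cup(\|\lnot\chi\|^M\times\|\lnot\chi\|^M)$. For $S\subseteq A$, the model $M^{S,\chi}=\langle W,R^{S,\chi},V\rangle$ has $R^{S,\chi}_i:=R_i\cap(R_S\cup\sim^M_\chi)$ (so $R^{\emptyset,\chi}_i=R_i$). The language $\mathcal{L}_{[S,\chi]}$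 is $\bigcup_{n}\mathcal{L}^n$ where $\mathcal{L}^0=\mathcal{L}_D$ and $\mathcal{L}^{n+1}$ extends $\mathcal{L}^n$ (closing under $\lnot,\land,D_G$) with formulas $[S,\chi]\varphi$ for $S\subseteq A$ and $\chi\in\mathcal{L}^n$; semantics: $(M,w)\Vdash[S,\chi]\varphi$ iff $(M^{S,\chi},w)\Vdash\varphi$. A collective $\mathtt{P}$-bisimulation between $M=\langle W,R,V\rangle$ and $M'=\langle W',R',V'\rangle$ is a non-empty $Z\subseteq W\times W'$ such that for every $(u,u')\in Z$: (atoms) for all $p\in\mathtt{P}$, $u\in V(p)$ iff $u'\in V'(p)$; (forth) for every $G\subseteq A$ and $v$ with $(u,v)\in R_G$ there is $v'$ with $(u',v')\in R'_G$ and $(v,v')\in Z$; (back) for every $G\subseteq A$ and $v'$ with $(u',v')\in R'_G$ there is $v$ with $(u,v)\in R_G$ and $(v,v')\in Z$. The pointed models $(M,w),(M',w')$ are collectively $\mathtt{P}$-bisimilar if some such $Z$ contains $(w,w')$. *)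

theory Defs
  imports "HOL-Library.Countable"
begin

text \<open>
  Agents are the elements of a type \<open>'a\<close> and atoms those of a type \<open>'p\<close> (all types are non-empty);
  finiteness of \<open>'a\<close> and countability of \<open>'p\<close> are sort constraints in the theorem.
  Models have an explicit carrier of worlds inside a type \<open>'w\<close>.
\<close>

record ('w, 'a, 'p) model =
  worlds :: "'w set"
  acc :: "'a \<Rightarrow> ('w \<times> 'w) set"
  val :: "'p \<Rightarrow> 'w set"

definition is_model :: "('w, 'a, 'p) model \<Rightarrow> bool" where
  "is_model M \<longleftrightarrow>
     worlds M \<noteq> {} \<and>
     (\<forall>i. acc M i \<subseteq> worlds M \<times> worlds M) \<and>
     (\<forall>p. val M p \<subseteq> worlds M)"

definition pointed_model :: "('w, 'a, 'p) model \<Rightarrow> 'w \<Rightarrow> bool" where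
  "pointed_model M w \<longleftrightarrow> is_model M \<and> w \<in> worlds M"

definition group_acc :: "('w, 'a, 'p) model \<Rightarrow> 'a set \<Rightarrow> ('w \<times> 'w) set" where
  "group_acc M G = (if G = {} then worlds M \<times> worlds M else (\<Inter>k\<in>G. acc M k))"

text \<open>
  Raw syntax. It still allows \<open>Dist {} \<phi>\<close>; the language proper is \<open>lang\<close> below.
  \<open>Comm S \<chi> \<phi>\<close> stands for \<open>[S,\<chi>]\<phi>\<close>.
\<close>

datatype ('a, 'p) fm =
    Atom 'p
  | Neg "('a, 'p) fm"
  | Conj "('a, 'p) fm" "('a, 'p) fm"
  | Dist "'a set" "('a, 'p) fm"
  | Comm "'a set" "('a, 'p) fm" "('a, 'p) fm"

text \<open>
  \<open>in_level n\<close> is the layer \<open>L^n\<close>. The rule for \<open>Comm\<close> never produces a formula at level \<open>0\<close>,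
  so that level is the language with distributed knowledge only.
\<close>

inductive in_level :: "nat \<Rightarrow> ('a, 'p) fm \<Rightarrow> bool" where
  Atom: "in_level n (Atom p)"
| Neg: "in_level n \<phi> \<Longrightarrow> in_level n (Neg \<phi>)"
| Conj: "in_level n \<phi> \<Longrightarrow> in_level n \<psi> \<Longrightarrow> in_level n (Conj \<phi> \<psi>)"
| Dist: "G \<noteq> {} \<Longrightarrow> in_level n \<phi> \<Longrightarrow> in_level n (Dist G \<phi>)"
| Comm: "in_level n \<chi> \<Longrightarrow> in_level (Suc n) \<phi> \<Longrightarrow> in_level (Suc n) (Comm S \<chi> \<phi>)"

lemma in_level_Suc: "in_level n \<phi> \<Longrightarrow> in_level (Suc n) \<phi>"
  by (induction rule: in_level.induct) (auto intro: in_level.intros)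

definition lang :: "('a, 'p) fm set" where
  "lang = (\<Union>n. {\<phi>. in_level n \<phi>})"

text \<open>
  The relation \<open>\<sim>\<close> and the updated model are first defined from an arbitrary set \<open>X\<close> of worlds,
  since they occur in the recursion for \<open>sat\<close> with \<open>X\<close> the truth set of \<open>\<chi>\<close>;
  the complement of \<open>X\<close> is then the truth set of \<open>Neg \<chi>\<close>.
\<close>

definition same_answer :: "('w, 'a, 'p) model \<Rightarrow> 'w set \<Rightarrow> ('w \<times> 'w) set" where
  "same_answer M X = (X \<times> X) \<union> ((worlds M - X) \<times> (worlds M - X))"

definition update_by :: "('w, 'a, 'p) model \<Rightarrow> 'a set \<Rightarrow> 'w set \<Rightarrow> ('w, 'a, 'p) model" where
  "update_by M S X = M\<lparr>acc := \<lambda>i. acc M i \<inter> (group_acc M S \<union> same_answer M X)\<rparr>"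

primrec sat :: "('a, 'p) fm \<Rightarrow> ('w, 'a, 'p) model \<Rightarrow> 'w \<Rightarrow> bool" where
  "sat (Atom p) M w \<longleftrightarrow> w \<in> val M p"
| "sat (Neg \<phi>) M w \<longleftrightarrow> \<not> sat \<phi> M w"
| "sat (Conj \<phi> \<psi>) M w \<longleftrightarrow> sat \<phi> M w \<and> sat \<psi> M w"
| "sat (Dist G \<phi>) M w \<longleftrightarrow> (\<forall>u. (w, u) \<in> group_acc M G \<longrightarrow> sat \<phi> M u)"
| "sat (Comm S \<chi> \<phi>) M w \<longleftrightarrow> sat \<phi> (update_by M S {u \<in> worlds M. sat \<chi> M u}) w"

definition truth_set :: "('a, 'p) fm \<Rightarrow> ('w, 'a, 'p) model \<Rightarrow> 'w set" where
  "truth_set \<chi> M = {u \<in> worlds M. sat \<chi> M u}"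

lemma same_answer_truth_set:
  "same_answer M (truth_set \<chi> M) =
     (truth_set \<chi> M \<times> truth_set \<chi> M) \<union> (truth_set (Neg \<chi>) M \<times> truth_set (Neg \<chi>) M)"
  by (auto simp: same_answer_def truth_set_def)

lemma sat_Comm: "sat (Comm S \<chi> \<phi>) M w \<longleftrightarrow> sat \<phi> (update_by M S (truth_set \<chi> M)) w"
  by (simp add: truth_set_def)

lemma acc_update_by_empty:
  "is_model M \<Longrightarrow> acc (update_by M {} X) i = acc M i"
  by (auto simp: is_model_def update_by_def group_acc_def)

lemma is_model_update_by:
  "is_model M \<Longrightarrow> is_model (update_by M S X)"
  by (auto simp: is_model_def update_by_def)

definition collective_bisim ::
  "('w, 'a, 'p) model \<Rightarrow> ('v, 'a, 'p) model \<Rightarrow> ('w \<times> 'v) set \<Rightarrow> bool" where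
  "collective_bisim M M' Z \<longleftrightarrow>
     Z \<noteq> {} \<and> Z \<subseteq> worlds M \<times> worlds M' \<and>
     (\<forall>(u, u') \<in> Z.
        (\<forall>p. u \<in> val M p \<longleftrightarrow> u' \<in> val M' p) \<and>
        (\<forall>G v. (u, v) \<in> group_acc M G \<longrightarrow>
           (\<exists>v'. (u', v') \<in> group_acc M' G \<and> (v, v') \<in> Z)) \<and>
        (\<forall>G v'. (u', v') \<in> group_acc M' G \<longrightarrow>
           (\<exists>v. (u, v) \<in> group_acc M G \<and> (v, v') \<in> Z)))"

definition collectively_bisimilar ::
  "('w, 'a, 'p) model \<Rightarrow> 'w \<Rightarrow> ('v, 'a, 'p) model \<Rightarrow> 'v \<Rightarrow> bool" where
  "collectively_bisimilar M w M' w' \<longleftrightarrow> (\<exists>Z. collective_bisim M M' Z \<and> (w, w') \<in> Z)"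

end

theory Submission
  imports Defs
begin

text \<open>
  A collective bisimulation remains one after both models are updated with \<open>[S,\<chi>]\<close>,
  provided it relates only worlds that agree on \<open>\<chi>\<close>. Indeed, a \<open>G\<close>-step that survives the update is
  either a \<open>G \<union> S\<close>-step or a \<open>G\<close>-step between worlds that agree on \<open>\<chi>\<close>, and in both cases the
  forth and back conditions of the original models provide a matching surviving step.
  Invariance then follows by induction on the formula, simultaneously for all pairs of models.
\<close>

lemma worlds_update_by [simp]: "worlds (update_by M S X) = worlds M"
  and val_update_by [simp]: "val (update_by M S X) = val M"
  by (simp_all add: update_by_def)

lemma group_acc_subset_worlds:
  "is_model M \<Longrightarrow> group_acc M G \<subseteq> worlds M \<times> worlds M"
  unfolding is_model_def group_acc_def by (cases "G = {}") (simp_all, blast)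

text \<open>If \<open>G\<close> or \<open>H\<close> is empty, its relation is the full square of
  \<open>worlds M\<close>, which is neutral for intersection because a model's relations stay inside
  that square.\<close>

lemma group_acc_Un:
  assumes "is_model M"
  shows "group_acc M (G \<union> H) = group_acc M G \<inter> group_acc M H"
proof (cases "G = {} \<or> H = {}")
  case True
  then show ?thesis
    using group_acc_subset_worlds[OF assms, of G] group_acc_subset_worlds[OF assms, of H]
    unfolding group_acc_def by (elim disjE) (simp_all add: Int_absorb1 Int_absorb2)
next
  case False
  then show ?thesis
    by (auto simp: group_acc_def)
qed

text \<open>The union with \<open>group_acc M S\<close> and \<open>same_answer M X\<close> is the
  same for every agent, so it factors out of the intersection over \<open>G\<close>. For empty
  \<open>G\<close> there is no agent to carry the restriction.\<close>

lemma group_acc_update_by: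
  "G \<noteq> {} \<Longrightarrow> group_acc (update_by M S X) G = group_acc M G \<inter> (group_acc M S \<union> same_answer M X)"
  unfolding group_acc_def[of _ G] by (auto simp: update_by_def)

lemma collective_bisim_converse:
  "collective_bisim M M' Z \<Longrightarrow> collective_bisim M' M (Z\<inverse>)"
  unfolding collective_bisim_def by (auto 0 3)

lemma collective_bisim_forth:
  assumes "collective_bisim M M' Z" "(u, u') \<in> Z" "(u, v) \<in> group_acc M G"
  obtains v' where "(u', v') \<in> group_acc M' G" "(v, v') \<in> Z"
  using assms unfolding collective_bisim_def by fast

lemma collective_bisim_worlds:
  assumes "collective_bisim M M' Z" "(u, u') \<in> Z"
  shows "u \<in> worlds M" "u' \<in> worlds M'"
  using assms unfolding collective_bisim_def by auto

text \<open>Arbitrary sets \<open>X\<close> and \<open>X'\<close> keep the statement symmetric in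
  the two models, so back follows by applying it to the converse of \<open>Z\<close>.\<close>

lemma update_by_forth:
  assumes "is_model M" "is_model M'"
    and bisim: "collective_bisim M M' Z"
    and agree: "\<And>x x'. (x, x') \<in> Z \<Longrightarrow> x \<in> X \<longleftrightarrow> x' \<in> X'"
    and Z: "(u, u') \<in> Z"
    and step: "(u, v) \<in> group_acc (update_by M S X) G"
  shows "\<exists>v'. (u', v') \<in> group_acc (update_by M' S X') G \<and> (v, v') \<in> Z"
proof (cases "G = {}")
  case True
  then have "group_acc (update_by M S X) G = group_acc M G"
    and "group_acc (update_by M' S X') G = group_acc M' G"
    by (simp_all add: group_acc_def)
  then show ?thesis
    using collective_bisim_forth[OF bisim Z] step by metis
next
  case False
  note upd = group_acc_update_by[OF False]
  from step have G: "(u, v) \<in> group_acc M G"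
    and "(u, v) \<in> group_acc M S \<or> (u, v) \<in> same_answer M X"
    by (auto simp: upd)
  from this(2) show ?thesis
  proof
    assume "(u, v) \<in> group_acc M S"
    \<comment> \<open>Matching the \<open>G\<close>-step and the \<open>S\<close>-step separately
      could give two different successors of \<open>u'\<close>; one step for
      \<open>G \<union> S\<close> yields a common one.\<close>
    with G have "(u, v) \<in> group_acc M (G \<union> S)"
      by (simp add: group_acc_Un[OF \<open>is_model M\<close>])
    then obtain v' where "(u', v') \<in> group_acc M' (G \<union> S)" "(v, v') \<in> Z"
      using collective_bisim_forth[OF bisim Z] by blast
    then show ?thesis
      by (auto simp: upd group_acc_Un[OF \<open>is_model M'\<close>])
  next
    assume same: "(u, v) \<in> same_answer M X"
    obtain v' where v': "(u', v') \<in> group_acc M' G" "(v, v') \<in> Z"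
      using collective_bisim_forth[OF bisim Z G] .
    \<comment> \<open>Membership in \<open>worlds\<close> is needed when both answers are negative,
      since \<open>same_answer\<close> takes complements relative to \<open>worlds\<close>.\<close>
    have "(u', v') \<in> same_answer M' X'"
      using same agree[OF Z] agree[OF v'(2)]
        collective_bisim_worlds[OF bisim Z] collective_bisim_worlds[OF bisim v'(2)]
      by (auto simp: same_answer_def)
    with v' show ?thesis
      by (auto simp: upd)
  qed
qed

lemma collective_bisim_update_by:
  assumes "is_model M" "is_model M'"
    and bisim: "collective_bisim M M' Z"
    and agree: "\<And>x x'. (x, x') \<in> Z \<Longrightarrow> x \<in> X \<longleftrightarrow> x' \<in> X'"
  shows "collective_bisim (update_by M S X) (update_by M' S X') Z"
proof -
  have forward: "\<exists>v'. (u', v') \<in> group_acc (update_by M' S X') G \<and> (v, v') \<in> Z"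
    if "(u, u') \<in> Z" "(u, v) \<in> group_acc (update_by M S X) G" for u u' v G
    using update_by_forth[OF assms that] .
  have backward: "\<exists>v. (u, v) \<in> group_acc (update_by M S X) G \<and> (v, v') \<in> Z"
    if "(u, u') \<in> Z" "(u', v') \<in> group_acc (update_by M' S X') G" for u u' v' G
    using update_by_forth[OF assms(2,1) collective_bisim_converse[OF bisim], of X' X u' u v' S G]
      agree that by simp
  show ?thesis
    using bisim forward backward unfolding collective_bisim_def by auto
qed

text \<open>The models vary in the induction while \<open>Z\<close> stays fixed, as updating
  preserves the very same \<open>Z\<close>. In the \<open>Comm\<close> case, the hypothesis for
  \<open>\<chi>\<close> is used on the original models and that for \<open>\<phi>\<close> on the
  updated ones.\<close>

lemma sat_collective_bisim:
  fixes M :: "('w, 'a, 'p) model" and M' :: "('v, 'a, 'p) model"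
  assumes "is_model M" "is_model M'" "collective_bisim M M' Z" "(w, w') \<in> Z"
  shows "sat \<psi> M w \<longleftrightarrow> sat \<psi> M' w'"
  using assms
proof (induction \<psi> arbitrary: M M' w w')
  case (Atom p)
  then show ?case
    unfolding collective_bisim_def by auto
next
  case (Dist G \<phi>)
  note bisim = Dist.prems(3) and Z = Dist.prems(4)
  have IH: "sat \<phi> M v \<longleftrightarrow> sat \<phi> M' v'" if "(v, v') \<in> Z" for v v'
    using Dist.IH Dist.prems that by blast
  show ?case
  proof
    assume "sat (Dist G \<phi>) M w"
    then show "sat (Dist G \<phi>) M' w'"
      using collective_bisim_forth[OF collective_bisim_converse[OF bisim], of w' w] Z IH
      by simp metis
  next
    assume "sat (Dist G \<phi>) M' w'"
    then show "sat (Dist G \<phi>) M w"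
      using collective_bisim_forth[OF bisim Z] IH by simp metis
  qed
next
  case (Comm S \<chi> \<phi>)
  note bisim = Comm.prems(3)
  have "x \<in> truth_set \<chi> M \<longleftrightarrow> x' \<in> truth_set \<chi> M'" if "(x, x') \<in> Z" for x x'
    using Comm.IH(1)[OF Comm.prems(1-3) that] collective_bisim_worlds[OF bisim that]
    by (simp add: truth_set_def)
  then have "collective_bisim (update_by M S (truth_set \<chi> M)) (update_by M' S (truth_set \<chi> M')) Z"
    by (rule collective_bisim_update_by[OF Comm.prems(1-3)])
  then show ?case
    unfolding sat_Comm
    by (intro Comm.IH(2) is_model_update_by Comm.prems)
qed simp_all

theorem theorem2p11:
  fixes M :: "('w, 'a::finite, 'p::countable) model"
    and M' :: "('v, 'a, 'p) model"
    and w :: 'w and w' :: 'v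
  assumes "pointed_model M w"
    and "pointed_model M' w'"
    and "collectively_bisimilar M w M' w'"
  shows "\<forall>\<psi> \<in> lang. sat \<psi> M w \<longleftrightarrow> sat \<psi> M' w'"
proof -
  obtain Z where "collective_bisim M M' Z" "(w, w') \<in> Z"
    using assms(3) unfolding collectively_bisimilar_def by blast
  then show ?thesis
    using assms(1,2) sat_collective_bisim unfolding pointed_model_def by metis
qed

end
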